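(* Let $G=(V,E)$ be a finite connected loopless multigraph with site energies $x_v>0$ ($v\in V$) and edge energies $y_e>0$ ($e\in E$). Then the function $\mathcal S_G^V(t)=\sum_{v\in V}x_v|t_v|+\sum_{e=uv\in E}y_e|t_u-t_v|$ on $\mathbb R^{V}$ is the support function of the in-in zonotope $\mathrm{Zono}(G)$, and $$\lim_{\alpha'\to0^+}\mathcal I_G^{\mathrm{zono}}(\alpha')=\int_{\mathbb R^{V}}e^{-\mathcal S_G^V(t)}\prod_{v\in V}\mathrm dt_v=|V|!\;\mathrm{Vol}\big(\mathrm{Zono}(G)^\vee\big).$$
   Context: Loopless means no self-loops; cycles and parallel edges are allowed, and parallel edges are distinct elements of $E$. Let $\mathbf e_v$ ($v\in V$) be the standard basis of $\mathbb R^V$. The in-in zonotope is the Minkowski sum $$\mathrm{Zono}(G)=\sum_{v\in V}x_v[-\mathbf e_v,\mathbf e_v]+\sum_{e=uv\in E}y_e[-(\mathbf e_u-\mathbf e_v),\,\mathbf e_u-\mathbf e_v]\subset\mathbb R^V .$$ The support function of a convex body $P$ is $h_P(t)=\max_{p\in P}\langle p,t\rangle$, its polar body is $P^\vee=\{t: h_P(t)\le 1\}$, and $\mathrm{Vol}$ is Lebesgue measure on $\mathbb R^V$. For $\alpha'>0$ the zonotopal stringy integral is $$\mathcal I_G^{\mathrm{zono}}(\alpha')=(\alpha')^{|V|}\int_{\mathbb R_{>0}^{V}}\prod_{v\in V}\frac{\mathrm dz_v}{z_v}\prod_{v\in V}(z_v+z_v^{-1})^{-\alpha' x_v}\prod_{e=uv\in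 E}\Big(\frac{z_u}{z_v}+\frac{z_v}{z_u}\Big)^{-\alpha' y_e}.$$ *)

theory Defs
  imports "HOL-Analysis.Analysis" "Graph_Theory.Digraph_Component"
begin

text \<open>
  An undirected multigraph is represented by a \<^typ>\<open>('v, 'e) pre_digraph\<close> that carries each edge
  exactly once, with an arbitrary reference orientation: the edge \<open>e = uv\<close> has \<open>u = tail G e\<close> and
  \<open>v = head G e\<close>, and parallel edges (in either orientation) are distinct elements of \<open>arcs G\<close>.
  Every definition below is invariant under reversing an edge.  The space of real vectors indexed
  by the vertices is \<^typ>\<open>real ^ 'v\<close>, so that the vertex set is the whole (finite) type \<open>'v\<close>.

  \<^const>\<open>Digraph_Component.connected\<close> is connectedness of the underlying undirected graph: it is
  defined through the symmetric closure of the arcs (and requires a vertex).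
\<close>

definition connected_loopless_multigraph :: "('v::finite, 'e) pre_digraph \<Rightarrow> bool" where
  "connected_loopless_multigraph G \<longleftrightarrow>
     fin_digraph G \<and> loopfree_digraph G \<and> Digraph_Component.connected G \<and> verts G = UNIV"

definition site_edge_energy ::
    "('v::finite, 'e) pre_digraph \<Rightarrow> ('v \<Rightarrow> real) \<Rightarrow> ('e \<Rightarrow> real) \<Rightarrow> real ^ 'v \<Rightarrow> real" where
  "site_edge_energy G x y t =
     (\<Sum>v\<in>UNIV. x v * \<bar>t $ v\<bar>) + (\<Sum>e\<in>arcs G. y e * \<bar>t $ tail G e - t $ head G e\<bar>)"

definition edge_vec :: "('v::finite, 'e) pre_digraph \<Rightarrow> 'e \<Rightarrow> real ^ 'v" where
  "edge_vec G e = axis (tail G e) 1 - axis (head G e) 1"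

text \<open>The sums in the following definition are Minkowski sums of sets.\<close>

definition zonotope ::
    "('v::finite, 'e) pre_digraph \<Rightarrow> ('v \<Rightarrow> real) \<Rightarrow> ('e \<Rightarrow> real) \<Rightarrow> (real ^ 'v) set" where
  "zonotope G x y =
     (\<Sum>v\<in>UNIV. (*\<^sub>R) (x v) ` closed_segment (- axis v 1) (axis v 1)) +
     (\<Sum>e\<in>arcs G. (*\<^sub>R) (y e) ` closed_segment (- edge_vec G e) (edge_vec G e))"

text \<open>\<open>GREATEST\<close> denotes the maximum, which is attained when \<open>P\<close> is a convex body.\<close>

definition support_function :: "'a::euclidean_space set \<Rightarrow> 'a \<Rightarrow> real" where
  "support_function P t = (GREATEST m. \<exists>p\<in>P. m = p \<bullet> t)"

definition polar_body :: "'a::euclidean_space set \<Rightarrow> 'a set" where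
  "polar_body P = {t. support_function P t \<le> 1}"

definition positive_orthant :: "(real ^ 'v::finite) set" where
  "positive_orthant = {z. \<forall>v. 0 < z $ v}"

definition stringy_integrand ::
    "('v::finite, 'e) pre_digraph \<Rightarrow> ('v \<Rightarrow> real) \<Rightarrow> ('e \<Rightarrow> real) \<Rightarrow> real \<Rightarrow> real ^ 'v \<Rightarrow> real" where
  "stringy_integrand G x y \<alpha> z =
     (\<Prod>v\<in>UNIV. 1 / z $ v) *
     (\<Prod>v\<in>UNIV. (z $ v + inverse (z $ v)) powr (- \<alpha> * x v)) *
     (\<Prod>e\<in>arcs G. (z $ tail G e / z $ head G e + z $ head G e / z $ tail G e) powr (- \<alpha> * y e))"

definition stringy_integral ::
    "('v::finite, 'e) pre_digraph \<Rightarrow> ('v \<Rightarrow> real) \<Rightarrow> ('e \<Rightarrow> real) \<Rightarrow> real \<Rightarrow> real" where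
  "stringy_integral G x y \<alpha> =
     \<alpha> ^ CARD('v) * (LINT z:positive_orthant|lborel. stringy_integrand G x y \<alpha> z)"

end

theory Submission
  imports Defs "HOL-Probability.Distributions"
begin

text \<open>
  The substitution \<open>z\<^sub>v = exp (t\<^sub>v / \<alpha>)\<close> absorbs \<open>\<alpha>\<^bsup>|V|\<^esup>\<close> together with the factors \<open>1 / z\<^sub>v\<close>, and
  turns every other factor into \<open>(exp (s / \<alpha>) + exp (- s / \<alpha>))\<^bsup>- \<alpha> c\<^esup>\<close>, which lies between
  \<open>2\<^bsup>- \<alpha> c\<^esup> exp (- c |s|)\<close> and \<open>exp (- c |s|)\<close>.  The limit therefore follows by dominated convergence,
  the limit function itself being the majorant.  Homogeneity of the energy and a layer cake
  argument evaluate the limit, and give its integrability because the polar body is bounded.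
\<close>

section \<open>Support function of the zonotope\<close>

lemma support_function_eqI:
  assumes "p \<in> P" "p \<bullet> t = m" "\<And>q. q \<in> P \<Longrightarrow> q \<bullet> t \<le> m"
  shows "support_function P t = m"
  unfolding support_function_def by (rule Greatest_equality) (use assms in auto)

text \<open>A linear functional is maximised on a Minkowski sum one summand at a time, and on a
  symmetric segment at one of the endpoints. Attainment and upper bound are separate conclusions
  because a maximum defined by \<open>GREATEST\<close> needs both.\<close>

lemma scaled_segment_sum_support:
  fixes a :: "'i \<Rightarrow> 'a::euclidean_space" and c :: "'i \<Rightarrow> real"
  assumes I: "finite I" and c: "\<And>i. i \<in> I \<Longrightarrow> c i \<ge> 0"
  defines "Z \<equiv> \<Sum>i\<in>I. (*\<^sub>R) (c i) ` closed_segment (- a i) (a i)"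
  shows "\<exists>p\<in>Z. p \<bullet> t = (\<Sum>i\<in>I. c i * \<bar>a i \<bullet> t\<bar>)"
    and "q \<in> Z \<Longrightarrow> q \<bullet> t \<le> (\<Sum>i\<in>I. c i * \<bar>a i \<bullet> t\<bar>)"
proof -
  have Z: "Z = {sum s I |s. \<forall>i\<in>I. s i \<in> (*\<^sub>R) (c i) ` closed_segment (- a i) (a i)}"
    unfolding Z_def by (rule set_sum_alt[OF I])
  define s where "s i = c i *\<^sub>R (if a i \<bullet> t \<ge> 0 then a i else - a i)" for i
  have "sum s I \<in> Z"
    unfolding Z mem_Collect_eq
  proof (intro exI[of _ s] conjI ballI)
    show "s i \<in> (*\<^sub>R) (c i) ` closed_segment (- a i) (a i)" for i
      unfolding s_def by (rule imageI) auto
  qed (rule refl)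
  moreover have "sum s I \<bullet> t = (\<Sum>i\<in>I. c i * \<bar>a i \<bullet> t\<bar>)"
    unfolding inner_sum_left by (rule sum.cong) (auto simp: s_def)
  ultimately show "\<exists>p\<in>Z. p \<bullet> t = (\<Sum>i\<in>I. c i * \<bar>a i \<bullet> t\<bar>)" by blast
  assume "q \<in> Z"
  then obtain s where q: "q = sum s I"
    and s: "\<And>i. i \<in> I \<Longrightarrow> s i \<in> (*\<^sub>R) (c i) ` closed_segment (- a i) (a i)"
    unfolding Z by blast
  have "s i \<bullet> t \<le> c i * \<bar>a i \<bullet> t\<bar>" if i: "i \<in> I" for i
  proof -
    obtain w where w: "w \<in> closed_segment (- a i) (a i)" "s i = c i *\<^sub>R w"
      using s[OF i] by blast
    then obtain r where l: "0 \<le> r" "r \<le> 1" "w = (1 - r) *\<^sub>R (- a i) + r *\<^sub>R a i"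
      unfolding closed_segment_def by blast
    have "w \<bullet> t = (2 * r - 1) * (a i \<bullet> t)"
      by (simp add: l inner_add_left inner_diff_left algebra_simps)
    also have "\<dots> \<le> \<bar>2 * r - 1\<bar> * \<bar>a i \<bullet> t\<bar>"
      by (metis abs_ge_self abs_mult)
    also have "\<dots> \<le> 1 * \<bar>a i \<bullet> t\<bar>"
      using l by (intro mult_right_mono) auto
    finally show ?thesis
      using c[OF i] w by (simp add: mult_left_mono)
  qed
  then show "q \<bullet> t \<le> (\<Sum>i\<in>I. c i * \<bar>a i \<bullet> t\<bar>)"
    unfolding q inner_sum_left by (rule sum_mono)
qed

text \<open>Pairing \<open>t\<close> with \<open>axis v 1\<close> and \<open>edge_vec G e\<close>
  gives the coordinates and coordinate differences in the energy, so the two Minkowski sums account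
  for its two sums.\<close>

lemma support_function_zonotope:
  assumes "finite (arcs G)" "\<And>v. x v \<ge> 0" "\<And>e. e \<in> arcs G \<Longrightarrow> y e \<ge> 0"
  shows "support_function (zonotope G x y) = site_edge_energy G x y"
proof
  fix t
  note V = scaled_segment_sum_support[where I = UNIV and c = x and a = "\<lambda>v. axis v 1" and t = t]
  note E = scaled_segment_sum_support[where I = "arcs G" and c = y and a = "edge_vec G" and t = t]
  have S: "site_edge_energy G x y t =
      (\<Sum>v\<in>UNIV. x v * \<bar>axis v 1 \<bullet> t\<bar>) + (\<Sum>e\<in>arcs G. y e * \<bar>edge_vec G e \<bullet> t\<bar>)"
    by (simp add: site_edge_energy_def edge_vec_def inner_diff_left inner_axis')
  obtain p where p: "p \<in> (\<Sum>v\<in>UNIV. (*\<^sub>R) (x v) ` closed_segment (- axis v 1) (axis v 1))"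
      "p \<bullet> t = (\<Sum>v\<in>UNIV. x v * \<bar>axis v 1 \<bullet> t\<bar>)"
    using V(1) assms by auto
  obtain q where q: "q \<in> (\<Sum>e\<in>arcs G. (*\<^sub>R) (y e) ` closed_segment (- edge_vec G e) (edge_vec G e))"
      "q \<bullet> t = (\<Sum>e\<in>arcs G. y e * \<bar>edge_vec G e \<bullet> t\<bar>)"
    using E(1) assms by auto
  show "support_function (zonotope G x y) t = site_edge_energy G x y t"
  proof (rule support_function_eqI)
    show "p + q \<in> zonotope G x y"
      using p q unfolding zonotope_def by blast
    show "(p + q) \<bullet> t = site_edge_energy G x y t"
      by (simp add: S inner_add_left p q)
    show "r \<bullet> t \<le> site_edge_energy G x y t" if r: "r \<in> zonotope G x y" for r
    proof -
      obtain p q where "r = p + q"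
        "p \<in> (\<Sum>v\<in>UNIV. (*\<^sub>R) (x v) ` closed_segment (- axis v 1) (axis v 1))"
        "q \<in> (\<Sum>e\<in>arcs G. (*\<^sub>R) (y e) ` closed_segment (- edge_vec G e) (edge_vec G e))"
        using r unfolding zonotope_def by (rule set_plus_elim)
      then show ?thesis
        unfolding S using V(2)[of p] E(2)[of q] assms by (simp add: inner_add_left add_mono)
    qed
  qed
qed

section \<open>Layer cake integral of a homogeneous exponential\<close>

lemma nn_integral_exp_neg_atLeast:
  "(\<integral>\<^sup>+u. ennreal (exp (- u)) * indicator {a..} u \<partial>lborel) = ennreal (exp (- a))" for a :: real
proof -
  have "((\<lambda>u::real. - exp (- u)) \<longlongrightarrow> - 0) at_top"
    by (intro tendsto_minus filterlim_compose[OF exp_at_bot] filterlim_uminus_at_bot_at_top)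
  then show ?thesis
    by (subst nn_integral_FTC_atLeast[where F = "\<lambda>u. - exp (- u)" and T = 0])
       (auto intro!: derivative_eq_intros)
qed

lemma emeasure_homogeneous_sublevel:
  fixes S :: "'a::euclidean_space \<Rightarrow> real"
  assumes [measurable]: "S \<in> borel_measurable borel"
    and hom: "\<And>c t. c > 0 \<Longrightarrow> S (c *\<^sub>R t) = c * S t"
    and u: "u > 0"
  shows "emeasure lborel {t. S t \<le> u} = ennreal (u ^ DIM('a)) * emeasure lborel {t. S t \<le> 1}"
proof -
  have sets: "{t. S t \<le> w} \<in> sets borel" for w by measurable
  have "t \<in> (\<lambda>t. u *\<^sub>R t + 0) ` {t. S t \<le> 1}" if "S t \<le> u" for t
    using that u by (intro image_eqI[where x = "(1 / u) *\<^sub>R t"]) (simp_all add: hom)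
  then have img: "(\<lambda>t. u *\<^sub>R t + 0) ` {t. S t \<le> 1} = {t. S t \<le> u}"
    using u by (auto simp: hom)
  \<comment> \<open>The scaling rule for affine images is used for \<open>lebesgue\<close>; the
    sublevel sets are Borel, so it carries over to \<open>lborel\<close>.\<close>
  have "emeasure lebesgue {t. S t \<le> u} = ennreal (u ^ DIM('a)) * emeasure lebesgue {t. S t \<le> 1}"
    using emeasure_lebesgue_affine[of u 0 "{t. S t \<le> 1}"] u unfolding img by simp
  then show ?thesis
    using sets by simp
qed

text \<open>Layer cake: \<open>exp (- S t)\<close> is the integral of \<open>exp (- u)\<close> over \<open>u \<ge> S t\<close>, and the sublevel
  set \<open>{S \<le> u}\<close> is the dilation of \<open>{S \<le> 1}\<close> by \<open>u\<close>.\<close>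

lemma nn_integral_exp_homogeneous:
  fixes S :: "'a::euclidean_space \<Rightarrow> real"
  assumes [measurable]: "S \<in> borel_measurable borel"
    and nonneg: "\<And>t. S t \<ge> 0"
    and hom: "\<And>c t. c > 0 \<Longrightarrow> S (c *\<^sub>R t) = c * S t"
  shows "(\<integral>\<^sup>+t. ennreal (exp (- S t)) \<partial>lborel) = ennreal (fact DIM('a)) * emeasure lborel {t. S t \<le> 1}"
proof -
  have "(\<integral>\<^sup>+t. ennreal (exp (- S t)) \<partial>lborel)
      = (\<integral>\<^sup>+t. (\<integral>\<^sup>+u. ennreal (exp (- u)) * indicator {S t..} u \<partial>lborel) \<partial>lborel)"
    by (simp add: nn_integral_exp_neg_atLeast)
  also have "\<dots> = (\<integral>\<^sup>+t. (\<integral>\<^sup>+u. ennreal (exp (- u)) * indicator {(t, u). S t \<le> u} (t, u) \<partial>lborel) \<partial>lborel)"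
    by (intro nn_integral_cong) (auto split: split_indicator)
  also have "\<dots> = (\<integral>\<^sup>+u. (\<integral>\<^sup>+t. ennreal (exp (- u)) * indicator {(t, u). S t \<le> u} (t, u) \<partial>lborel) \<partial>lborel)"
  proof (rule lborel_pair.Fubini'[symmetric])
    have "(\<lambda>p. ennreal (exp (- snd p)) * indicator {p. S (fst p) \<le> snd p} p)
        \<in> borel_measurable (lborel \<Otimes>\<^sub>M (lborel :: real measure))"
      by measurable
    then show "(\<lambda>(t, u). ennreal (exp (- u)) * indicator {(t, u). S t \<le> u} (t, u))
        \<in> borel_measurable (lborel \<Otimes>\<^sub>M (lborel :: real measure))"
      by (simp add: case_prod_beta')
  qed
  also have "\<dots> = (\<integral>\<^sup>+u. (\<integral>\<^sup>+t. ennreal (exp (- u)) * indicator {t. S t \<le> u} t \<partial>lborel) \<partial>lborel)"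
    by (intro nn_integral_cong) (auto split: split_indicator)
  also have "\<dots> = (\<integral>\<^sup>+u. ennreal (exp (- u)) * emeasure lborel {t. S t \<le> u} \<partial>lborel)"
  proof (rule nn_integral_cong)
    fix u
    have "{t. S t \<le> u} \<in> sets lborel"
      by simp
    then show "(\<integral>\<^sup>+t. ennreal (exp (- u)) * indicator {t. S t \<le> u} t \<partial>lborel)
        = ennreal (exp (- u)) * emeasure lborel {t. S t \<le> u}"
      by (rule nn_integral_cmult_indicator)
  qed
  \<comment> \<open>Homogeneity settles only \<open>u > 0\<close>. For \<open>u < 0\<close> the
    sublevel set is empty because \<open>S\<close> is nonnegative, and the point
    \<open>u = 0\<close> is a null set.\<close>
  also have "\<dots> = (\<integral>\<^sup>+u. (ennreal (u ^ DIM('a) * exp (- u)) * indicator {0..} u)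
                      * emeasure lborel {t. S t \<le> 1} \<partial>lborel)"
  proof (rule nn_integral_cong_AE, use AE_lborel_singleton[of 0] in eventually_elim)
    case (elim u)
    show ?case
    proof (cases "u > 0")
      case True
      then show ?thesis
        using emeasure_homogeneous_sublevel[OF assms(1) hom True] by (simp add: ennreal_mult mult_ac)
    next
      case False
      with elim have "u < 0" by simp
      then have "{t. S t \<le> u} = {}"
        using nonneg by (auto simp: not_le intro: less_le_trans)
      then show ?thesis
        using \<open>u < 0\<close> by simp
    qed
  qed
  \<comment> \<open>The remaining integral of \<open>u ^ DIM('a) * exp (- u)\<close> over the half
    line is a Gamma integral, the source of the factorial.\<close>
  also have "\<dots> = ennreal (fact DIM('a)) * emeasure lborel {t. S t \<le> 1}"
    by (subst nn_integral_multc) (auto simp: nn_intergal_power_times_exp_Ici)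
  finally show ?thesis .
qed

section \<open>Lebesgue measure in logarithmic coordinates\<close>

text \<open>The criterion \<open>lborel_eqI\<close> measures boxes by products over
  \<open>Basis\<close>; this turns them into products over coordinates.\<close>

lemma prod_Basis_vec:
  "(\<Prod>b\<in>(Basis :: (real ^ 'n::finite) set). f b) = (\<Prod>i\<in>UNIV. f (axis i 1))"
proof -
  have "Basis = range (\<lambda>i. axis i 1 :: real ^ 'n)"
    by (auto simp: Basis_vec_def)
  moreover have "inj (\<lambda>i. axis i 1 :: real ^ 'n)"
    by (auto simp: inj_def axis_eq_axis)
  ultimately show ?thesis
    using prod.reindex[of "\<lambda>i. axis i 1 :: real ^ 'n" UNIV f] by (simp add: comp_def)
qed

lemma borel_measurable_vec_lambda:
  assumes "\<And>i. (\<lambda>x. f x i) \<in> borel_measurable M"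
  shows "(\<lambda>x. \<chi> i. f x i :: real ^ 'n::finite) \<in> borel_measurable M"
  using assms by (subst borel_measurable_euclidean_space) (auto simp: Basis_vec_def inner_axis)

lemma measurable_vec_lambda_PiM:
  "vec_lambda \<in> borel_measurable (\<Pi>\<^sub>M i\<in>(UNIV::'n::finite set). (lborel :: real measure))"
proof -
  have "(\<lambda>x. \<chi> i. x i) \<in> borel_measurable (\<Pi>\<^sub>M i\<in>(UNIV::'n set). (lborel :: real measure))"
    by (rule borel_measurable_vec_lambda) measurable
  then show ?thesis by simp
qed

text \<open>Lebesgue measure is determined by its values on boxes, and the product measure also
  gives a box the product of its side lengths. This opens \<open>real ^ 'n\<close> to the theory of
  product measures.\<close>

lemma lborel_vec_eq_distr_PiM:
  "(lborel :: (real ^ 'n::finite) measure) = distr (\<Pi>\<^sub>M i\<in>UNIV. lborel) borel vec_lambda"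
proof (rule lborel_eqI)
  interpret product_sigma_finite "\<lambda>_::'n. lborel :: real measure" ..
  note [measurable] = measurable_vec_lambda_PiM
  fix l u :: "real ^ 'n"
  assume lu: "\<And>b. b \<in> Basis \<Longrightarrow> l \<bullet> b \<le> u \<bullet> b"
  have le: "l $ i \<le> u $ i" for i
    using lu[of "axis i 1"] by (simp add: inner_axis)
  have "emeasure (distr (\<Pi>\<^sub>M i\<in>UNIV. lborel) borel vec_lambda) (box l u)
      = emeasure (\<Pi>\<^sub>M i\<in>UNIV. lborel) (vec_lambda -` box l u \<inter> space (\<Pi>\<^sub>M i\<in>(UNIV::'n set). (lborel :: real measure)))"
    by (subst emeasure_distr) auto
  also have "vec_lambda -` box l u \<inter> space (\<Pi>\<^sub>M i\<in>(UNIV::'n set). (lborel :: real measure))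
      = Pi\<^sub>E UNIV (\<lambda>i. {l $ i <..< u $ i})"
    by (auto simp: mem_box_cart space_PiM PiE_def Pi_def)
  also have "emeasure (\<Pi>\<^sub>M i\<in>UNIV. lborel) (Pi\<^sub>E UNIV (\<lambda>i. {l $ i <..< u $ i}))
      = (\<Prod>i\<in>UNIV. emeasure lborel {l $ i <..< u $ i})"
    by (rule emeasure_PiM) auto
  also have "\<dots> = ennreal (\<Prod>i\<in>UNIV. u $ i - l $ i)"
    by (simp add: le prod_ennreal)
  finally show "emeasure (distr (\<Pi>\<^sub>M i\<in>UNIV. lborel) borel vec_lambda) (box l u)
      = (\<Prod>b\<in>Basis. (u - l) \<bullet> b)"
    by (simp add: prod_Basis_vec inner_axis)
qed simp

text \<open>Tonelli for integrands that factor over the coordinates; it splits the weighted volume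
  of a box into one-dimensional integrals.\<close>

lemma nn_integral_lborel_vec_prod:
  fixes f :: "'n::finite \<Rightarrow> real \<Rightarrow> ennreal"
  assumes [measurable]: "\<And>i. f i \<in> borel_measurable borel"
  shows "(\<integral>\<^sup>+z. (\<Prod>i\<in>UNIV. f i (z $ i)) \<partial>lborel) = (\<Prod>i\<in>UNIV. \<integral>\<^sup>+s. f i s \<partial>lborel)"
proof -
  interpret product_sigma_finite "\<lambda>_::'n. lborel :: real measure" ..
  have "(\<integral>\<^sup>+z. (\<Prod>i\<in>UNIV. f i (z $ i)) \<partial>lborel)
      = (\<integral>\<^sup>+z. (\<Prod>i\<in>UNIV. f i (z i)) \<partial>(\<Pi>\<^sub>M i\<in>UNIV. lborel))"
    by (subst lborel_vec_eq_distr_PiM, subst nn_integral_distr)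
       (auto intro: measurable_vec_lambda_PiM)
  also have "\<dots> = (\<Prod>i\<in>UNIV. \<integral>\<^sup>+s. f i s \<partial>lborel)"
    by (rule product_nn_integral_prod) auto
  finally show ?thesis .
qed

text \<open>The primitive is \<open>a * ln s\<close>, and the scale \<open>a\<close> cancels against
  the endpoints \<open>exp (l / a)\<close> and \<open>exp (u / a)\<close>.\<close>

lemma nn_integral_inverse_exp_interval:
  fixes a l u :: real
  assumes "a > 0" "l \<le> u"
  shows "(\<integral>\<^sup>+s. ennreal (a / s) * indicator {exp (l / a)<..<exp (u / a)} s \<partial>lborel) = ennreal (u - l)"
proof -
  have "(\<integral>\<^sup>+s. ennreal (a / s) * indicator {exp (l / a)<..<exp (u / a)} s \<partial>lborel)
      = (\<integral>\<^sup>+s. ennreal (a / s) * indicator {exp (l / a)..exp (u / a)} s \<partial>lborel)"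
    by (rule nn_integral_cong_AE,
        use AE_lborel_singleton[of "exp (l / a)"] AE_lborel_singleton[of "exp (u / a)"] in eventually_elim)
       (auto split: split_indicator)
  also have "\<dots> = ennreal (a * ln (exp (u / a)) - a * ln (exp (l / a)))"
  proof (rule nn_integral_FTC_Icc)
    fix s assume "s \<in> {exp (l / a)..exp (u / a)}"
    then have "s > 0"
      using exp_gt_zero[of "l / a"] by (auto simp del: exp_gt_zero)
    then show "((\<lambda>s. a * ln s) has_real_derivative a / s) (at s)"
      by (auto intro!: derivative_eq_intros)
    show "0 \<le> a / s"
      using \<open>s > 0\<close> assms by simp
  qed (use assms in \<open>auto simp: divide_right_mono\<close>)
  also have "\<dots> = ennreal (u - l)"
    using assms by simp
  finally show ?thesis .
qed

text \<open>It suffices to compare both measures on boxes, where the density factorises and the change of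
  variables is the one-dimensional integral of \<open>a / s\<close>.\<close>

lemma lborel_vec_log_substitution:
  assumes a: "a > 0"
  shows "(lborel :: (real ^ 'n::finite) measure) =
    distr (density lborel (\<lambda>z. \<Prod>i\<in>UNIV. ennreal (a / z $ i) * indicator {0<..} (z $ i)))
      borel (\<lambda>z. \<chi> i. a * ln (z $ i))"
proof (rule lborel_eqI)
  have [measurable]: "(\<lambda>z :: real ^ 'n. \<chi> i. a * ln (z $ i)) \<in> borel_measurable borel"
    by (rule borel_measurable_vec_lambda) measurable
  have [measurable]: "(\<lambda>z :: real ^ 'n. \<chi> i. a * ln (z $ i)) -` B \<in> sets borel" if "B \<in> sets borel" for B
    by (rule measurable_sets_borel[OF _ that]) measurable
  let ?d = "\<lambda>z :: real ^ 'n. \<Prod>i\<in>UNIV. ennreal (a / z $ i) * indicator {0<..} (z $ i)"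
  fix l u :: "real ^ 'n"
  assume lu: "\<And>b. b \<in> Basis \<Longrightarrow> l \<bullet> b \<le> u \<bullet> b"
  have le: "l $ i \<le> u $ i" for i
    using lu[of "axis i 1"] by (simp add: inner_axis)
  have iff: "l $ i < a * ln s \<and> a * ln s < u $ i \<longleftrightarrow> exp (l $ i / a) < s \<and> s < exp (u $ i / a)"
    if "s > 0" for s i
  proof -
    have "l $ i < a * ln s \<longleftrightarrow> l $ i / a < ln s" "a * ln s < u $ i \<longleftrightarrow> ln s < u $ i / a"
      using a by (simp_all add: field_simps)
    then show ?thesis
      using that by (metis exp_less_cancel_iff exp_ln)
  qed
  have "emeasure (distr (density lborel ?d) borel (\<lambda>z. \<chi> i. a * ln (z $ i))) (box l u)
      = (\<integral>\<^sup>+z. ?d z * indicator ((\<lambda>z. \<chi> i. a * ln (z $ i)) -` box l u) z \<partial>lborel)"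
    by (subst emeasure_distr, measurable, subst emeasure_density) auto
  also have "\<dots> = (\<integral>\<^sup>+z. (\<Prod>i\<in>UNIV. ennreal (a / z $ i) * indicator {exp (l $ i / a)<..<exp (u $ i / a)} (z $ i)) \<partial>lborel)"
  proof (rule nn_integral_cong)
    fix z :: "real ^ 'n"
    show "?d z * indicator ((\<lambda>z. \<chi> i. a * ln (z $ i)) -` box l u) z
      = (\<Prod>i\<in>UNIV. ennreal (a / z $ i) * indicator {exp (l $ i / a)<..<exp (u $ i / a)} (z $ i))"
    proof (cases "\<forall>i. z $ i > 0")
      case True
      have "indicator ((\<lambda>z. \<chi> i. a * ln (z $ i)) -` box l u) z
          = (\<Prod>i\<in>UNIV. indicator {exp (l $ i / a)<..<exp (u $ i / a)} (z $ i) :: ennreal)"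
        using iff True by (auto simp: mem_box_cart indicator_def prod_zero_iff)
      then show ?thesis
        using True by (simp add: prod.distrib)
    next
      \<comment> \<open>Off the positive orthant both sides vanish, whatever \<open>ln\<close>
        returns there: on the left through the indicator in the density, on the right because a
        nonpositive coordinate lies below the positive left endpoint.\<close>
      case False
      then obtain i where "z $ i \<le> 0" by (auto simp: not_less)
      moreover from this have "\<not> exp (l $ i / a) < z $ i"
        by (smt (verit) exp_gt_zero)
      ultimately show ?thesis
        by (subst (1 2) prod_zero) (auto intro!: exI[of _ i] bexI[of _ i])
    qed
  qed
  also have "\<dots> = (\<Prod>i\<in>UNIV. ennreal (u $ i - l $ i))"
    by (subst nn_integral_lborel_vec_prod) (auto simp: nn_integral_inverse_exp_interval[OF a le])
  also have "\<dots> = (\<Prod>b\<in>Basis. (u - l) \<bullet> b)"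
    by (simp add: prod_Basis_vec inner_axis prod_ennreal le)
  finally show "emeasure (distr (density lborel ?d) borel (\<lambda>z. \<chi> i. a * ln (z $ i))) (box l u)
      = (\<Prod>b\<in>Basis. (u - l) \<bullet> b)" .
qed simp

lemma borel_measurable_positive_orthant [measurable]: "positive_orthant \<in> sets borel"
  unfolding positive_orthant_def by measurable

text \<open>The identity of measures is passed to integrals: \<open>distr\<close> becomes
  composition and \<open>density\<close> a factor. The form \<open>has_bochner_integral\<close>
  transports convergence and value together.\<close>

lemma has_bochner_integral_log_substitution:
  fixes f :: "real ^ 'n::finite \<Rightarrow> real"
  assumes a: "a > 0" and [measurable]: "f \<in> borel_measurable borel"
    and f: "has_bochner_integral lborel f I"
  shows "has_bochner_integral lborel
    (\<lambda>z. indicator positive_orthant z * ((\<Prod>i\<in>UNIV. a / z $ i) * f (\<chi> i. a * ln (z $ i)))) I"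
proof -
  let ?d = "\<lambda>z :: real ^ 'n. indicator positive_orthant z * (\<Prod>i\<in>UNIV. a / z $ i) :: real"
  let ?T = "\<lambda>z :: real ^ 'n. \<chi> i. a * ln (z $ i)"
  have T [measurable]: "?T \<in> borel_measurable borel"
    by (rule borel_measurable_vec_lambda) measurable
  \<comment> \<open>The product of extended factors is rewritten as a single nonnegative real
    density, the form that Bochner integrals against a density require.\<close>
  have d: "(\<Prod>i\<in>UNIV. ennreal (a / z $ i) * indicator {0<..} (z $ i)) = ennreal (?d z)" for z
  proof (cases "z \<in> positive_orthant")
    case True
    then show ?thesis
      using a by (simp add: positive_orthant_def prod_ennreal less_imp_le)
  next
    case False
    then show ?thesis
      by (auto simp: positive_orthant_def prod_zero_iff indicator_def)
  qed
  have d_nonneg: "?d z \<ge> 0" for z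
    using a by (auto simp: positive_orthant_def indicator_def less_imp_le intro!: prod_nonneg)
  have eq: "lborel = distr (density lborel (\<lambda>z. ennreal (?d z))) borel ?T"
    using lborel_vec_log_substitution[OF a, where 'n = 'n] unfolding d .
  have "has_bochner_integral (distr (density lborel (\<lambda>z. ennreal (?d z))) borel ?T) f I"
    using f eq by simp
  then have "has_bochner_integral (density lborel (\<lambda>z. ennreal (?d z))) (\<lambda>z. f (?T z)) I"
    by (simp add: has_bochner_integral_iff integrable_distr_eq integral_distr)
  then have "has_bochner_integral lborel (\<lambda>z. ?d z *\<^sub>R f (?T z)) I"
    by (simp add: has_bochner_integral_iff integrable_density integral_density d_nonneg
        del: real_scaleR_def)
  then show ?thesis
    by (simp add: mult.assoc)
qed

section \<open>Exponential bounds and pointwise limit\<close>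

lemma exp_add_exp_neg_bounds:
  fixes s :: real
  shows "exp \<bar>s\<bar> \<le> exp s + exp (- s)" "exp s + exp (- s) \<le> 2 * exp \<bar>s\<bar>"
  by (auto simp: abs_if)

text \<open>The exponent is nonpositive, so a lower bound of the base bounds the power from above.
  The parameter \<open>a\<close> then cancels, which makes the bound uniform in
  \<open>a\<close>.\<close>

lemma exp_add_exp_neg_powr_le:
  fixes a c s :: real
  assumes "a > 0" "c \<ge> 0"
  shows "(exp (s / a) + exp (- (s / a))) powr (- a * c) \<le> exp (- (c * \<bar>s\<bar>))"
proof -
  have "(exp (s / a) + exp (- (s / a))) powr (- a * c) \<le> exp \<bar>s / a\<bar> powr (- a * c)"
    using assms exp_add_exp_neg_bounds(1)[of "s / a"] by (intro powr_mono2') auto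
  also have "\<dots> = exp (- (c * \<bar>s\<bar>))"
    using assms by (simp add: powr_def)
  finally show ?thesis .
qed

text \<open>The lower bound differs from the upper one only by \<open>2 powr (- a * c)\<close>,
  which tends to 1 as \<open>a\<close> tends to 0.\<close>

lemma exp_add_exp_neg_powr_ge:
  fixes a c s :: real
  assumes "a > 0" "c \<ge> 0"
  shows "2 powr (- a * c) * exp (- (c * \<bar>s\<bar>)) \<le> (exp (s / a) + exp (- (s / a))) powr (- a * c)"
proof -
  have "2 powr (- a * c) * exp (- (c * \<bar>s\<bar>)) = (2 * exp \<bar>s / a\<bar>) powr (- a * c)"
    using assms by (simp add: powr_mult) (simp add: powr_def)
  also have "\<dots> \<le> (exp (s / a) + exp (- (s / a))) powr (- a * c)"
    using assms exp_add_exp_neg_bounds(2)[of "s / a"] by (intro powr_mono2') (auto intro: add_pos_pos)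
  finally show ?thesis .
qed

text \<open>For \<open>s \<noteq> 0\<close> the base diverges while the exponent tends to 0, so the
  limit is obtained by squeezing between the two bounds.\<close>

lemma exp_add_exp_neg_powr_tendsto:
  fixes c s :: real
  assumes "c \<ge> 0"
  shows "((\<lambda>a. (exp (s / a) + exp (- (s / a))) powr (- a * c)) \<longlongrightarrow> exp (- (c * \<bar>s\<bar>))) (at_right 0)"
proof (rule tendsto_sandwich)
  have "((\<lambda>a. 2 powr (- a * c) * exp (- (c * \<bar>s\<bar>))) \<longlongrightarrow> 2 powr (- 0 * c) * exp (- (c * \<bar>s\<bar>))) (at_right 0)"
    by (intro tendsto_intros) auto
  then show "((\<lambda>a. 2 powr (- a * c) * exp (- (c * \<bar>s\<bar>))) \<longlongrightarrow> exp (- (c * \<bar>s\<bar>))) (at_right 0)"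
    by simp
  show "\<forall>\<^sub>F a in at_right 0. 2 powr (- a * c) * exp (- (c * \<bar>s\<bar>)) \<le> (exp (s / a) + exp (- (s / a))) powr (- a * c)"
    using eventually_at_right_less[of 0] by eventually_elim (use assms exp_add_exp_neg_powr_ge in auto)
  show "\<forall>\<^sub>F a in at_right 0. (exp (s / a) + exp (- (s / a))) powr (- a * c) \<le> exp (- (c * \<bar>s\<bar>))"
    using eventually_at_right_less[of 0] by eventually_elim (use assms exp_add_exp_neg_powr_le in auto)
qed simp

text \<open>The stringy integrand in the coordinates \<open>t $ v = a * ln (z $ v)\<close>, after
  the Jacobian has absorbed the factors \<open>1 / z $ v\<close> and the prefactor.\<close>

definition log_integrand ::
    "('v::finite, 'e) pre_digraph \<Rightarrow> ('v \<Rightarrow> real) \<Rightarrow> ('e \<Rightarrow> real) \<Rightarrow> real \<Rightarrow> real ^ 'v \<Rightarrow> real" where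
  "log_integrand G x y a t =
     (\<Prod>v\<in>UNIV. (exp (t $ v / a) + exp (- (t $ v / a))) powr (- a * x v)) *
     (\<Prod>e\<in>arcs G. (exp ((t $ tail G e - t $ head G e) / a) + exp (- ((t $ tail G e - t $ head G e) / a)))
        powr (- a * y e))"

lemma borel_measurable_log_integrand [measurable]: "log_integrand G x y a \<in> borel_measurable borel"
  unfolding log_integrand_def by measurable

lemma log_integrand_nonneg: "log_integrand G x y a t \<ge> 0"
  unfolding log_integrand_def by (intro mult_nonneg_nonneg prod_nonneg) auto

text \<open>Each \<open>1 / z $ v\<close> receives one factor \<open>a\<close> of the prefactor,
  which produces exactly the density of the logarithmic substitution.\<close>

lemma stringy_integrand_conv_log_integrand:
  assumes a: "a > 0" and z: "z \<in> positive_orthant"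
  shows "a ^ CARD('v) * stringy_integrand G x y a z =
    (\<Prod>v\<in>UNIV. a / z $ v) * log_integrand G x y a (\<chi> v. a * ln (z $ v :: real) :: real ^ 'v::finite)"
proof -
  have pos: "z $ v > 0" for v
    using z by (simp add: positive_orthant_def)
  have "z $ u / z $ v + z $ v / z $ u
      = exp ((a * ln (z $ u) - a * ln (z $ v)) / a) + exp (- ((a * ln (z $ u) - a * ln (z $ v)) / a))" for u v
    using a pos[of u] pos[of v] by (simp add: diff_divide_distrib exp_diff)
  moreover have "z $ v + inverse (z $ v) = exp (a * ln (z $ v) / a) + exp (- (a * ln (z $ v) / a))" for v
    using a pos[of v] by (simp add: exp_minus)
  moreover have "a ^ CARD('v) * (\<Prod>v\<in>UNIV. 1 / z $ v) = (\<Prod>v\<in>UNIV. a / z $ v)"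
    by (simp add: prod_dividef)
  ultimately show ?thesis
    unfolding stringy_integrand_def log_integrand_def
    by (simp only: vec_lambda_beta mult.assoc[symmetric])
qed

text \<open>The product has the same shape as \<open>log_integrand\<close>, so bounds and limits can
  be taken factor by factor.\<close>

lemma exp_neg_site_edge_energy:
  assumes "finite (arcs G)"
  shows "exp (- site_edge_energy G x y t) =
    (\<Prod>v\<in>UNIV. exp (- (x v * \<bar>t $ v\<bar>))) *
    (\<Prod>e\<in>arcs G. exp (- (y e * \<bar>t $ tail G e - t $ head G e\<bar>)))"
  using assms by (simp add: site_edge_energy_def exp_add exp_diff exp_minus exp_sum prod_dividef divide_simps prod_inversef)

lemma log_integrand_le:
  assumes "finite (arcs G)" "\<And>v. x v \<ge> 0" "\<And>e. e \<in> arcs G \<Longrightarrow> y e \<ge> 0" "a > 0"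
  shows "log_integrand G x y a t \<le> exp (- site_edge_energy G x y t)"
  unfolding log_integrand_def exp_neg_site_edge_energy[OF assms(1)]
  using assms by (intro mult_mono prod_mono conjI exp_add_exp_neg_powr_le prod_nonneg) auto

lemma log_integrand_tendsto:
  assumes "finite (arcs G)" "\<And>v. x v \<ge> 0" "\<And>e. e \<in> arcs G \<Longrightarrow> y e \<ge> 0"
  shows "((\<lambda>a. log_integrand G x y a t) \<longlongrightarrow> exp (- site_edge_energy G x y t)) (at_right 0)"
  unfolding log_integrand_def exp_neg_site_edge_energy[OF assms(1)]
  using assms by (intro tendsto_mult tendsto_prod exp_add_exp_neg_powr_tendsto) auto

section \<open>Integrability of the limit function\<close>

lemma borel_measurable_site_edge_energy [measurable]: "site_edge_energy G x y \<in> borel_measurable borel"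
  unfolding site_edge_energy_def by measurable

lemma site_edge_energy_scaleR:
  "c > 0 \<Longrightarrow> site_edge_energy G x y (c *\<^sub>R t) = c * site_edge_energy G x y t"
  by (simp add: site_edge_energy_def sum_distrib_left distrib_left abs_mult mult_ac
      flip: right_diff_distrib)

lemma site_edge_energy_ge_site:
  assumes "\<And>v. x v \<ge> 0" "\<And>e. e \<in> arcs G \<Longrightarrow> y e \<ge> 0"
  shows "x v * \<bar>t $ v\<bar> \<le> site_edge_energy G x y t"
proof -
  have "x v * \<bar>t $ v\<bar> \<le> (\<Sum>v\<in>UNIV. x v * \<bar>t $ v\<bar>)"
    using assms by (intro member_le_sum) auto
  also have "\<dots> \<le> site_edge_energy G x y t"
    using assms by (auto simp: site_edge_energy_def intro!: sum_nonneg)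
  finally show ?thesis .
qed

text \<open>Edge terms vanish on constant vectors; it is the strictly positive site energies that
  keep \<open>\<bar>t $ v\<bar>\<close> below \<open>1 / x v\<close>.\<close>

lemma bounded_site_edge_energy_sublevel:
  assumes "\<And>v. x v > 0" "\<And>e. e \<in> arcs G \<Longrightarrow> y e \<ge> 0"
  shows "bounded {t. site_edge_energy G x y t \<le> 1}"
proof (rule bounded_subset[OF bounded_cbox])
  show "{t. site_edge_energy G x y t \<le> 1} \<subseteq> cbox (\<chi> v. - (1 / x v)) (\<chi> v. 1 / x v)"
  proof
    fix t assume "t \<in> {t. site_edge_energy G x y t \<le> 1}"
    then have "x v * \<bar>t $ v\<bar> \<le> 1" for v
      using site_edge_energy_ge_site[of x G y v t] assms by (auto simp: less_imp_le intro: order_trans)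
    then have "\<bar>t $ v\<bar> \<le> 1 / x v" for v
      using assms(1)[of v] by (simp add: field_simps)
    then show "t \<in> cbox (\<chi> v. - (1 / x v)) (\<chi> v. 1 / x v)"
      by (simp add: mem_box_cart abs_le_iff) (meson minus_le_iff)
  qed
qed

text \<open>A bounded sublevel set has finite volume, which turns the extended layer cake formula
  into integrability with a real value.\<close>

lemma has_bochner_integral_exp_site_edge_energy:
  fixes G :: "('v::finite, 'e) pre_digraph"
  assumes "\<And>v. x v > 0" "\<And>e. e \<in> arcs G \<Longrightarrow> y e \<ge> 0"
  shows "has_bochner_integral lborel (\<lambda>t. exp (- site_edge_energy G x y t))
    (fact CARD('v) * measure lborel {t. site_edge_energy G x y t \<le> 1})"
proof (rule has_bochner_integral_nn_integral)
  let ?A = "{t. site_edge_energy G x y t \<le> 1}"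
  have nonneg: "site_edge_energy G x y t \<ge> 0" for t
    using assms by (auto simp: site_edge_energy_def less_imp_le intro!: add_nonneg_nonneg sum_nonneg)
  have "emeasure lborel ?A < \<infinity>"
    by (intro emeasure_bounded_finite bounded_site_edge_energy_sublevel assms)
  then have "emeasure lborel ?A = ennreal (measure lborel ?A)"
    by (intro emeasure_eq_ennreal_measure) auto
  then show "(\<integral>\<^sup>+t. ennreal (exp (- site_edge_energy G x y t)) \<partial>lborel) = ennreal (fact CARD('v) * measure lborel ?A)"
    using nn_integral_exp_homogeneous[OF borel_measurable_site_edge_energy nonneg site_edge_energy_scaleR]
    by (simp add: ennreal_mult)
qed auto

section \<open>Convergence and limit of the stringy integral\<close>

text \<open>Integrability in \<open>t\<close> travels through the substitution; dividing by the
  positive power \<open>a ^ CARD('v)\<close> then gives convergence on the orthant.\<close>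

lemma stringy_integral_conv_log_integrand:
  fixes G :: "('v::finite, 'e) pre_digraph"
  assumes a: "a > 0" and int: "integrable lborel (log_integrand G x y a)"
  shows "set_integrable lborel positive_orthant (stringy_integrand G x y a)"
    and "stringy_integral G x y a = (LINT t|lborel. log_integrand G x y a t)"
proof -
  have "has_bochner_integral lborel
      (\<lambda>z. indicator positive_orthant z * ((\<Prod>v\<in>UNIV. a / z $ v) * log_integrand G x y a (\<chi> v. a * ln (z $ v))))
      (LINT t|lborel. log_integrand G x y a t)"
    by (intro has_bochner_integral_log_substitution a has_bochner_integral_integrable int) measurable
  \<comment> \<open>On the orthant this is the pointwise identity of the integrands; elsewhere the
    indicator makes both sides 0.\<close>
  also have "(\<lambda>z. indicator positive_orthant z * ((\<Prod>v\<in>UNIV. a / z $ v) * log_integrand G x y a (\<chi> v. a * ln (z $ v))))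
      = (\<lambda>z. a ^ CARD('v) * (indicator positive_orthant z *\<^sub>R stringy_integrand G x y a z))"
    by (auto simp: fun_eq_iff indicator_def stringy_integrand_conv_log_integrand[OF a])
  finally have *: "has_bochner_integral lborel
      (\<lambda>z. a ^ CARD('v) * (indicator positive_orthant z *\<^sub>R stringy_integrand G x y a z))
      (LINT t|lborel. log_integrand G x y a t)" .
  then show "set_integrable lborel positive_orthant (stringy_integrand G x y a)"
    using a by (simp add: set_integrable_def has_bochner_integral_iff)
  show "stringy_integral G x y a = (LINT t|lborel. log_integrand G x y a t)"
    using * by (simp add: stringy_integral_def set_lebesgue_integral_def has_bochner_integral_iff)
qed

theorem mainTheorem1:
  fixes G :: "('v::finite, 'e) pre_digraph"
    and x :: "'v \<Rightarrow> real"
    and y :: "'e \<Rightarrow> real"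
  assumes "connected_loopless_multigraph G"
    and "\<And>v. x v > 0"
    and "\<And>e. e \<in> arcs G \<Longrightarrow> y e > 0"
  shows "support_function (zonotope G x y) = site_edge_energy G x y
    \<and> (\<forall>\<alpha>>0. set_integrable lborel positive_orthant (stringy_integrand G x y \<alpha>))
    \<and> integrable lborel (\<lambda>t :: real ^ 'v. exp (- site_edge_energy G x y t))
    \<and> ((stringy_integral G x y \<longlongrightarrow> (LINT t|lborel. exp (- site_edge_energy G x y t))) (at_right 0))
    \<and> (LINT t|lborel. exp (- site_edge_energy G x y t))
        = fact CARD('v) * measure lebesgue (polar_body (zonotope G x y))"
proof (intro conjI allI impI)
  have fin: "finite (arcs G)"
    using assms(1) by (simp add: connected_loopless_multigraph_def fin_digraph_def fin_digraph_axioms_def)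
  have x: "x v \<ge> 0" for v
    using assms(2)[of v] by simp
  have y: "y e \<ge> 0" if "e \<in> arcs G" for e
    using assms(3)[OF that] by simp
  show supp: "support_function (zonotope G x y) = site_edge_energy G x y"
    using fin x y by (rule support_function_zonotope)
  note bochner = has_bochner_integral_exp_site_edge_energy[where G = G, OF assms(2) y]
  show int: "integrable lborel (\<lambda>t. exp (- site_edge_energy G x y t))"
    using bochner by (simp add: has_bochner_integral_iff)
  have "polar_body (zonotope G x y) = {t. site_edge_energy G x y t \<le> 1}"
    by (simp add: polar_body_def supp)
  \<comment> \<open>The sublevel set is Borel, so \<open>lborel\<close> and its completion agree on
    it.\<close>
  moreover have "measure lebesgue {t. site_edge_energy G x y t \<le> 1} = measure lborel {t. site_edge_energy G x y t \<le> 1}"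
    by (rule measure_completion) simp
  ultimately show "(LINT t|lborel. exp (- site_edge_energy G x y t))
      = fact CARD('v) * measure lebesgue (polar_body (zonotope G x y))"
    using bochner by (simp add: has_bochner_integral_iff)
  \<comment> \<open>Domination by the exponential of the energy makes the integral converge for
    every positive parameter, so none of the values is the default 0 of a divergent
    integral.\<close>
  have log_int: "integrable lborel (log_integrand G x y a)" if "a > 0" for a
    by (rule Bochner_Integration.integrable_bound[OF int])
       (auto simp: log_integrand_nonneg intro!: log_integrand_le fin x y that)
  show "set_integrable lborel positive_orthant (stringy_integrand G x y \<alpha>)" if "\<alpha> > 0" for \<alpha>
    by (rule stringy_integral_conv_log_integrand(1)[OF that log_int[OF that]])
  \<comment> \<open>Dominated convergence is applied along sequences tending to 0 from the right;
    the upper end 1 is an arbitrary positive number.\<close>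
  show "(stringy_integral G x y \<longlongrightarrow> (LINT t|lborel. exp (- site_edge_energy G x y t))) (at_right 0)"
  proof (rule tendsto_at_right_sequentially[of 0 1])
    fix a :: "nat \<Rightarrow> real"
    assume pos: "\<And>n. 0 < a n" and lim: "a \<longlonglongrightarrow> 0"
    have "filterlim a (at_right 0) sequentially"
      using pos lim by (auto simp: filterlim_at less_imp_neq[THEN not_sym])
    then have "(\<lambda>n. log_integrand G x y (a n) t) \<longlonglongrightarrow> exp (- site_edge_energy G x y t)" for t
      using log_integrand_tendsto[OF fin x y] by (rule filterlim_compose[rotated])
    then have "(\<lambda>n. LINT t|lborel. log_integrand G x y (a n) t) \<longlonglongrightarrow> (LINT t|lborel. exp (- site_edge_energy G x y t))"
      by (intro integral_dominated_convergence[where w = "\<lambda>t. exp (- site_edge_energy G x y t)"] int)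
         (auto simp: log_integrand_nonneg intro!: log_integrand_le fin x y pos)
    then show "(\<lambda>n. stringy_integral G x y (a n)) \<longlonglongrightarrow> (LINT t|lborel. exp (- site_edge_energy G x y t))"
      by (simp add: stringy_integral_conv_log_integrand(2)[OF pos log_int[OF pos]])
  qed simp
qed

end
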